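(* Let $k\in\{1,-1\}$ and let $X$ be an $n\times n$ $(0,k)$-matrix, with $\mathcal R$ the set of type $1$ row regions of $X$ and $\mathcal S$ the set of type $1$ column regions of $X$. Suppose no region in $\mathcal R$ or $\mathcal S$ is empty, and $|\mathcal R|=|\mathcal S|=m$. Then there exists an $n\times n$ alternating sign matrix $A$ such that $A(k)=X$ if and only if there is no non-overlapping set of $r$ regions in $\mathcal R$ and $s$ regions in $\mathcal S$ with $r+s=m+1$.
   Context: An alternating sign matrix (ASM) is a $(0,1,-1)$-matrix with the property that the non-zero entries in each row and column alternate in sign, beginning and ending with $+1$. For an $n\times n$ matrix $A$ with entries in $\{0,1,-1\}$ and $k\in\{1,-1\}$, $A(k)$ denotes the matrix obtained from $A$ by replacing all entries equal to $-k$ by $0$. Let $X$ be an $n\times n$ $(0,k)$-matrix, i.e. a matrix with entries in $\{0,k\}$. The row/column regions of $X$ are the contiguous $0$ entries occupying a single row/column of $X$ such that the first (resp. last) entry in the region is either the first (resp. last) entry of the row/column or has a non-zero directly before (resp. after) it. If two non-zero entries are next to one another, we say there is an empty row/column region between them. The type $k$ regions are the subset of row/column regions with the entry directly before and after the region equal to $k$. The type $-k$ regions are the entire set of row/column regions. Thus the type $1$ regions are the type $k$ regions when $k=1$, and the type $-k$ regions when $k=-1$. A set of row regions and column regions has an overlap if there is a row region and a column region among them with an entry (position) in common; otherwise it is non-overlapping.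
   Formalization: For k=1, X is also assumed to have no zero row or column (X=(0), n=1 is a counterexample otherwise); a non-zero first or last entry of a row/column counts as having an empty region beside it, so for k=-1 border entries -1 are excluded (else X=(-1) is a counterexample). *)

theory Defs
  imports "Jordan_Normal_Form.Matrix"
begin

text \<open>Matrices are indexed from 0. The non-zero entries of a line of an alternating sign matrix
  begin with 1, so there is at least one of them; this rules out zero rows and columns.
  Accordingly a \<open>(0,1)\<close>-matrix that is the positive part of one has no zero row or column.\<close>

definition alternating_line :: "int vec \<Rightarrow> bool" where
  "alternating_line v \<longleftrightarrow>
     (let ys = filter (\<lambda>x. x \<noteq> 0) (list_of_vec v) in
        ys \<noteq> [] \<and> hd ys = 1 \<and> last ys = 1 \<and> successively (\<lambda>x y. y = - x) ys)"

definition alternating_sign_matrix :: "nat \<Rightarrow> int mat \<Rightarrow> bool" where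
  "alternating_sign_matrix n A \<longleftrightarrow>
     A \<in> carrier_mat n n \<and> elements_mat A \<subseteq> {0, 1, -1} \<and>
     (\<forall>i<n. alternating_line (row A i)) \<and> (\<forall>j<n. alternating_line (col A j))"

definition sign_part :: "int \<Rightarrow> int mat \<Rightarrow> int mat" where
  "sign_part k A = map_mat (\<lambda>x. if x = - k then 0 else x) A"

text \<open>A region of a line is given by its end points: \<open>(a, b)\<close> stands for the positions
  \<open>a, \<dots>, b - 1\<close>, and \<open>a = b\<close> is an empty region. The end points are kept, rather than just the set
  of positions, so that different empty regions remain different. Two adjacent non-zero entries
  have an empty region between them; the same conditions also give an empty region between the end
  of a line and a non-zero entry in its first or last position.\<close>

definition line_regions :: "int vec \<Rightarrow> (nat \<times> nat) set" where
  "line_regions v = {(a, b). a \<le> b \<and> b \<le> dim_vec v \<and> (\<forall>j\<in>{a..<b}. v $ j = 0) \<and>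
     (a = 0 \<or> v $ (a - 1) \<noteq> 0) \<and> (b = dim_vec v \<or> v $ b \<noteq> 0)}"

text \<open>The regions of type \<open>t\<close> in a line with entries in \<open>{0, k}\<close>, where \<open>t\<close> is \<open>k\<close> or \<open>- k\<close>.\<close>

definition typed_line_regions :: "int \<Rightarrow> int \<Rightarrow> int vec \<Rightarrow> (nat \<times> nat) set" where
  "typed_line_regions k t v =
     (if t = k then {(a, b) \<in> line_regions v. 0 < a \<and> b < dim_vec v \<and> v $ (a - 1) = k \<and> v $ b = k}
      else if t = - k then line_regions v
      else {})"

text \<open>A triple \<open>(i, a, b)\<close> is the region \<open>(a, b)\<close> of the row, or column, with index \<open>i\<close>.\<close>

definition row_regions :: "int \<Rightarrow> int \<Rightarrow> int mat \<Rightarrow> (nat \<times> nat \<times> nat) set" where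
  "row_regions k t X = {(i, a, b). i < dim_row X \<and> (a, b) \<in> typed_line_regions k t (row X i)}"

definition col_regions :: "int \<Rightarrow> int \<Rightarrow> int mat \<Rightarrow> (nat \<times> nat \<times> nat) set" where
  "col_regions k t X = {(j, a, b). j < dim_col X \<and> (a, b) \<in> typed_line_regions k t (col X j)}"

fun row_cells :: "nat \<times> nat \<times> nat \<Rightarrow> (nat \<times> nat) set" where
  "row_cells (i, a, b) = {i} \<times> {a..<b}"

fun col_cells :: "nat \<times> nat \<times> nat \<Rightarrow> (nat \<times> nat) set" where
  "col_cells (j, a, b) = {a..<b} \<times> {j}"

definition non_overlapping :: "(nat \<times> nat \<times> nat) set \<Rightarrow> (nat \<times> nat \<times> nat) set \<Rightarrow> bool" where
  "non_overlapping P Q \<longleftrightarrow> (\<forall>p\<in>P. \<forall>q\<in>Q. row_cells p \<inter> col_cells q = {})"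

end

theory Submission
  imports Defs
begin

text \<open>
  To complete \<open>X\<close> to an alternating sign matrix means to choose the positions of the entries \<open>- k\<close>. In an
  alternating line the entries \<open>- k\<close> interlace with the entries \<open>k\<close>: there is exactly one of them in
  each type \<open>1\<close> region and none elsewhere (\<open>alternating_line_iff_regions\<close>). The uniform treatment of
  both signs rests on padding a line with an entry \<open>-1\<close> at both ends: then a line is alternating if
  and only if any two equal non-zero entries are separated by one of the opposite sign, and the type
  \<open>1\<close> regions are the gaps between consecutive entries \<open>k\<close>.

  Hence a completion of \<open>X\<close> is the same as a set \<open>M\<close> of cells that meets each row region and each column
  region exactly once and has no cell outside the row regions or outside the column regions
  (\<open>alternating_sign_matrix_iff_transversal\<close>). Regions of the same direction are pairwise disjoint.
  Therefore such a set amounts to a perfect matching between \<open>R\<close> and \<open>S\<close> in the bipartite graph in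
  which a row region and a column region are adjacent if they overlap: a cell of \<open>M\<close> joins the two
  regions that it lies in. A non-overlapping set of regions is an independent set of this graph.
  As both sides have \<open>m\<close> members, Hall's theorem says that there is a perfect matching unless there are
  \<open>m + 1\<close> independent vertices (\<open>exact_cover_iff_no_large_disjoint_families\<close>).
\<close>

section \<open>Alternating lines\<close>

text \<open>The line with an extra \<open>-1\<close> before its first and after its last entry, so that position \<open>j\<close> of the
  line becomes position \<open>Suc j\<close>. The two extra entries turn the conditions that the non-zero entries
  begin and end with \<open>1\<close> into instances of alternation.\<close>

definition padded :: "int vec \<Rightarrow> nat \<Rightarrow> int" where
  "padded v i = (if i = 0 \<or> dim_vec v < i then -1 else v $ (i - 1))"

lemma first_filtered_iff:
  "(\<forall>j<length xs. P (xs ! j) \<and> (\<forall>l<j. \<not> P (xs ! l)) \<longrightarrow> Q (xs ! j)) \<longleftrightarrow>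
    (filter P xs = [] \<or> Q (hd (filter P xs)))"
  by (induction xs) (auto simp: All_less_Suc2)

text \<open>Neighbours in the filtered list are the pairs of selected positions with no selected position
  between them.\<close>

lemma successively_filter_iff_nth:
  "successively Q (filter P xs) \<longleftrightarrow>
    (\<forall>j<length xs. \<forall>i<j. P (xs ! i) \<and> P (xs ! j) \<and> (\<forall>l<j. i < l \<longrightarrow> \<not> P (xs ! l))
      \<longrightarrow> Q (xs ! i) (xs ! j))"
proof (induction xs)
  case (Cons x xs)
  have "successively Q (filter P (x # xs)) \<longleftrightarrow>
      (P x \<longrightarrow> filter P xs = [] \<or> Q x (hd (filter P xs))) \<and> successively Q (filter P xs)"
    by (auto simp: successively_Cons)
  then show ?case
    unfolding Cons.IH first_filtered_iff[symmetric]
    by (auto simp: All_less_Suc2)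
qed simp

text \<open>A form of alternation that needs no list of non-zero entries and treats the two signs alike: two
  equal non-zero entries are always separated by one of the opposite sign. If the entries alternate,
  the first non-zero entry after the left one of the two has the opposite sign; conversely two
  neighbouring non-zero entries have nothing between them, so they cannot be equal.\<close>

lemma successively_alternating_iff:
  fixes xs :: "int list"
  assumes "set xs \<subseteq> {0, 1, -1}"
  shows "successively (\<lambda>x y. y = - x) (filter (\<lambda>x. x \<noteq> 0) xs) \<longleftrightarrow>
    (\<forall>j<length xs. \<forall>i<j. xs ! i = xs ! j \<and> xs ! i \<noteq> 0 \<longrightarrow> (\<exists>l>i. l < j \<and> xs ! l = - xs ! i))"
    (is "?L \<longleftrightarrow> ?R")
proof
  assume L: ?L
  show ?R
  proof (intro allI impI, elim conjE)
    fix i j assume ij: "j < length xs" "i < j" "xs ! i = xs ! j" "xs ! i \<noteq> 0"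
    define l where "l = (LEAST l. i < l \<and> xs ! l \<noteq> 0)"
    have l: "i < l \<and> xs ! l \<noteq> 0"
      unfolding l_def by (rule LeastI[of _ j]) (use ij in auto)
    have le: "l \<le> j"
      unfolding l_def by (rule Least_le) (use ij in auto)
    have "\<forall>l'<l. i < l' \<longrightarrow> xs ! l' = 0"
      unfolding l_def using not_less_Least by blast
    moreover have "l < length xs" using le ij by simp
    ultimately have "xs ! l = - xs ! i"
      using L l ij unfolding successively_filter_iff_nth by blast
    moreover from this have "l \<noteq> j" using ij by auto
    ultimately show "\<exists>l>i. l < j \<and> xs ! l = - xs ! i" using l le by auto
  qed
next
  assume R: ?R
  have *: "xs ! i \<in> {0, 1, -1}" if "i < length xs" for i
    using assms that nth_mem by blast
  show ?L
    unfolding successively_filter_iff_nth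
  proof (intro allI impI, elim conjE)
    fix i j assume ij: "j < length xs" "i < j" "xs ! i \<noteq> 0" "xs ! j \<noteq> 0"
      and z: "\<forall>l<j. i < l \<longrightarrow> \<not> xs ! l \<noteq> 0"
    have "xs ! i \<noteq> xs ! j"
    proof
      assume "xs ! i = xs ! j"
      then obtain l where "i < l" "l < j" "xs ! l = - xs ! i" using R ij by blast
      then show False using z ij by auto
    qed
    then show "xs ! j = - xs ! i" using *[of i] *[of j] ij by auto
  qed
qed

lemma alternating_line_iff_padded:
  assumes "set\<^sub>v v \<subseteq> {0, 1, -1}"
  shows "alternating_line v \<longleftrightarrow>
    (\<forall>j\<le>Suc (dim_vec v). \<forall>i<j. padded v i = padded v j \<and> padded v i \<noteq> 0 \<longrightarrow>
      (\<exists>l>i. l < j \<and> padded v l = - padded v i))"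
proof -
  define ys where "ys = filter (\<lambda>x. x \<noteq> 0) (list_of_vec v)"
  define xs where "xs = -1 # list_of_vec v @ [-1]"
  have len: "length xs = Suc (Suc (dim_vec v))" by (simp add: xs_def)
  have nth: "xs ! i = padded v i" if "i \<le> Suc (dim_vec v)" for i
    using that by (cases i) (auto simp: xs_def padded_def nth_append list_of_vec_index)
  have xs: "set xs \<subseteq> {0, 1, -1}"
    using assms by (auto simp: xs_def set_list_of_vec)
  have "alternating_line v \<longleftrightarrow> ys \<noteq> [] \<and> hd ys = 1 \<and> last ys = 1 \<and> successively (\<lambda>x y. y = - x) ys"
    by (simp add: alternating_line_def ys_def Let_def)
  also have "\<dots> \<longleftrightarrow> successively (\<lambda>x y. y = - x) (-1 # ys @ [-1])"
    by (cases "ys = []") (auto simp: successively_Cons successively_append_iff)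
  also have "-1 # ys @ [-1] = filter (\<lambda>x. x \<noteq> 0) xs"
    by (simp add: xs_def ys_def)
  finally show ?thesis
    unfolding successively_alternating_iff[OF xs] len
    by (simp add: nth less_Suc_eq_le cong: conj_cong)
qed

section \<open>Alternation and the regions of a line\<close>

definition sign_part_vec :: "int \<Rightarrow> int vec \<Rightarrow> int vec" where
  "sign_part_vec k = map_vec (\<lambda>x. if x = - k then 0 else x)"

text \<open>In the padded line the type \<open>1\<close> regions have the same description for both signs: they are the
  stretches between two consecutive entries \<open>k\<close>. For \<open>k = -1\<close> the added entries \<open>-1\<close> delimit the
  regions at the ends of the line; for \<open>k = 1\<close> they are not equal to \<open>k\<close>, so that the outermost zeros of
  the line belong to no region. Region \<open>(a, b)\<close> lies between the padded positions \<open>a\<close> and \<open>Suc b\<close>.\<close>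

lemma typed_line_regions_iff_gap:
  assumes "k \<in> {1, -1}" "set\<^sub>v v \<subseteq> {0, 1, -1}"
  shows "(a, b) \<in> typed_line_regions k 1 (sign_part_vec k v) \<longleftrightarrow>
    a \<le> b \<and> b \<le> dim_vec v \<and> padded v a = k \<and> padded v (Suc b) = k \<and>
    (\<forall>j\<in>{a<..b}. padded v j \<noteq> k)"
proof -
  define w where "w = sign_part_vec k v"
  have dim: "dim_vec w = dim_vec v"
    by (simp add: w_def sign_part_vec_def)
  have "v $ j \<in> {0, 1, -1}" if "j < dim_vec v" for j
    using vec_setI[OF refl that] assms(2) by blast
  then have w: "w $ j = 0 \<longleftrightarrow> v $ j \<noteq> k" "w $ j = k \<longleftrightarrow> v $ j = k" if "j < dim_vec v" for j
    using that assms(1) by (force simp: w_def sign_part_vec_def)+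
  have regions: "(a, b) \<in> line_regions w \<longleftrightarrow>
      a \<le> b \<and> b \<le> dim_vec v \<and> (\<forall>j\<in>{a..<b}. v $ j \<noteq> k) \<and>
      (a = 0 \<or> v $ (a - 1) = k) \<and> (b = dim_vec v \<or> v $ b = k)"
  proof -
    have "(\<forall>j\<in>{a..<b}. w $ j = 0) \<longleftrightarrow> (\<forall>j\<in>{a..<b}. v $ j \<noteq> k)" if "b \<le> dim_vec v"
      using that w(1) by auto
    moreover have "w $ (a - 1) \<noteq> 0 \<longleftrightarrow> v $ (a - 1) = k" if "a \<le> b" "b \<le> dim_vec v" "a \<noteq> 0"
      using that w(1)[of "a - 1"] by linarith
    moreover have "w $ b \<noteq> 0 \<longleftrightarrow> v $ b = k" if "b \<le> dim_vec v" "b \<noteq> dim_vec v"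
      using that w(1)[of b] by linarith
    ultimately show ?thesis
      unfolding line_regions_def dim by auto
  qed
  have shift: "(\<forall>j\<in>{a<..b}. padded v j \<noteq> k) \<longleftrightarrow> (\<forall>j\<in>{a..<b}. v $ j \<noteq> k)" if "b \<le> dim_vec v"
  proof -
    have "{a<..b} = Suc ` {a..<b}"
      by (simp add: image_Suc_atLeastLessThan atLeastSucAtMost_greaterThanAtMost atLeastLessThanSuc_atLeastAtMost)
    then show ?thesis using that by (auto simp: padded_def simp del: image_Suc_atLeastLessThan)
  qed
  show ?thesis
  proof (cases "k = 1")
    case True
    then show ?thesis
      unfolding typed_line_regions_def w_def[symmetric]
      using regions shift w by (auto simp: dim padded_def)
  next
    case False
    then have "k = -1" using assms(1) by simp
    then show ?thesis
      unfolding typed_line_regions_def w_def[symmetric]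
      using regions shift by (auto simp: padded_def)
  qed
qed

lemma gap_around:
  fixes p :: "nat \<Rightarrow> 'a"
  assumes "x < j" "j < y" "p x = k" "p y = k" "p j \<noteq> k"
  obtains a b where "a < j" "j \<le> b" "b < y" "x \<le> a" "p a = k" "p (Suc b) = k" "\<forall>l\<in>{a<..b}. p l \<noteq> k"
proof -
  define a where "a = (GREATEST a. a < j \<and> p a = k)"
  define c where "c = (LEAST c. j < c \<and> p c = k)"
  have a: "a < j \<and> p a = k" unfolding a_def by (rule GreatestI_nat[of _ x j]) (use assms in auto)
  have xa: "x \<le> a" unfolding a_def by (rule Greatest_le_nat[of _ x j]) (use assms in auto)
  have a_max: "l \<le> a" if "l < j" "p l = k" for l
    unfolding a_def by (rule Greatest_le_nat[of _ _ j]) (use that in auto)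
  have c: "j < c \<and> p c = k" unfolding c_def by (rule LeastI[of _ y]) (use assms in auto)
  have c_min: "c \<le> l" if "j < l" "p l = k" for l
    unfolding c_def by (rule Least_le) (use that in auto)
  have "p l \<noteq> k" if "l \<in> {a<..c - 1}" for l
    using that a_max[of l] c_min[of l] assms(5) c by (cases l j rule: linorder_cases) auto
  then show thesis
    using that[of a "c - 1"] a c c_min[of y] assms xa by auto
qed

text \<open>Between consecutive entries \<open>k\<close> of an alternating line there is exactly one \<open>- k\<close>, and each \<open>- k\<close> has
  a \<open>k\<close> on both sides of it (in the padded line). Conversely, two entries \<open>k\<close> are separated by the
  entry \<open>- k\<close> of the region that starts after the first of them, and two entries \<open>- k\<close> never share a
  region, so if one of them lies in a region, an end point of that region separates them. The only
  pair without a region consists of the two added entries \<open>-1\<close> when \<open>k = 1\<close>: the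
  first condition supplies the \<open>1\<close> between them.\<close>

lemma alternating_line_iff_regions:
  assumes k: "k \<in> {1, -1}" and v: "set\<^sub>v v \<subseteq> {0, 1, -1}"
  defines "T \<equiv> typed_line_regions k 1 (sign_part_vec k v)"
  shows "alternating_line v \<longleftrightarrow>
    (k = 1 \<longrightarrow> (\<exists>j<dim_vec v. v $ j = 1)) \<and>
    (\<forall>(a, b)\<in>T. \<exists>!j. j \<in> {a..<b} \<and> v $ j = - k) \<and>
    (\<forall>j<dim_vec v. v $ j = - k \<longrightarrow> (\<exists>(a, b)\<in>T. j \<in> {a..<b}))"
    (is "_ \<longleftrightarrow> ?one \<and> ?unique \<and> ?cover")
proof -
  let ?p = "padded v"
  let ?n = "dim_vec v"
  note T = typed_line_regions_iff_gap[OF k v, folded T_def]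
  have p_Suc: "?p (Suc j) = v $ j" if "j < ?n" for j
    using that by (simp add: padded_def)
  have p_end: "?p 0 = -1" "?p (Suc ?n) = -1"
    by (simp_all add: padded_def)
  show ?thesis
    unfolding alternating_line_iff_padded[OF v]
  proof (intro iffI conjI)
    assume *: "\<forall>j\<le>Suc ?n. \<forall>i<j. ?p i = ?p j \<and> ?p i \<noteq> 0 \<longrightarrow> (\<exists>l>i. l < j \<and> ?p l = - ?p i)"
    have alt: "\<exists>l>i. l < j \<and> ?p l = - c" if "i < j" "j \<le> Suc ?n" "?p i = c" "?p j = c" "c \<noteq> 0" for i j c
      using * that by auto
    show ?one
    proof
      obtain l where "0 < l" "l < Suc ?n" "?p l = 1"
        using alt[of 0 "Suc ?n" "-1"] p_end by auto
      then show "\<exists>j<?n. v $ j = 1"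
        using p_Suc[of "l - 1"] by (intro exI[of _ "l - 1"]) auto
    qed
    show ?unique
    proof clarify
      fix a b assume "(a, b) \<in> T"
      then have ab: "a \<le> b" "b \<le> ?n" "?p a = k" "?p (Suc b) = k" "\<forall>j\<in>{a<..b}. ?p j \<noteq> k"
        using T by auto
      obtain l where l: "a < l" "l < Suc b" "?p l = - k"
        using alt[of a "Suc b" k] ab k by auto
      show "\<exists>!j. j \<in> {a..<b} \<and> v $ j = - k"
      proof (rule ex_ex1I)
        show "\<exists>j. j \<in> {a..<b} \<and> v $ j = - k"
          using l ab p_Suc[of "l - 1"] by (intro exI[of _ "l - 1"]) auto
      next
        have less: False if ij: "i < j" "i \<in> {a..<b}" "v $ i = - k" "j \<in> {a..<b}" "v $ j = - k" for i j
        proof -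
          have "i < ?n" "j < ?n" using ij ab(2) by auto
          then obtain l where "Suc i < l" "l < Suc j" "?p l = k"
            using alt[of "Suc i" "Suc j" "- k"] ij p_Suc[of i] p_Suc[of j] k by auto
          then show False using ab ij by auto
        qed
        fix i j
        assume "i \<in> {a..<b} \<and> v $ i = - k" "j \<in> {a..<b} \<and> v $ j = - k"
        then show "i = j" using less[of i j] less[of j i] by (cases i j rule: linorder_cases) auto
      qed
    qed
    show ?cover
    proof (intro allI impI)
      fix j assume j: "j < ?n" "v $ j = - k"
      have pj: "?p (Suc j) = - k" using j p_Suc by simp
      obtain x y where xy: "x < Suc j" "Suc j < y" "?p x = k" "?p y = k" "y \<le> Suc ?n"
      proof (cases "k = 1")
        case True
        obtain x where "x < Suc j" "?p x = 1"
          using alt[of 0 "Suc j" "-1"] pj True j p_end by auto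
        moreover obtain y where "Suc j < y" "y < Suc ?n" "?p y = 1"
          using alt[of "Suc j" "Suc ?n" "-1"] pj True j p_end by auto
        ultimately show thesis using that True by auto
      next
        case False
        then show thesis using that[of 0 "Suc ?n"] p_end j k by auto
      qed
      have "?p (Suc j) \<noteq> k" using pj k by auto
      from gap_around[OF xy(1-4) this] obtain a b where
        "a < Suc j" "Suc j \<le> b" "b < y" "?p a = k" "?p (Suc b) = k" "\<forall>l\<in>{a<..b}. ?p l \<noteq> k"
        by metis
      then have "(a, b) \<in> T \<and> j \<in> {a..<b}" using xy unfolding T by auto
      then show "\<exists>(a, b)\<in>T. j \<in> {a..<b}" by blast
    qed
  next
    assume "?one \<and> ?unique \<and> ?cover"
    then have one: ?one and unique: ?unique and cover: ?cover by blast+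
    have gap: "\<exists>a b. (a, b) \<in> T \<and> a < i \<and> i \<le> b" if i: "0 < i" "i \<le> ?n" "?p i = - k" for i
    proof -
      have less: "i - 1 < ?n" using i by linarith
      have "v $ (i - 1) = - k" using i p_Suc[OF less] by simp
      then obtain a b where "(a, b) \<in> T" "i - 1 \<in> {a..<b}"
        using cover less by blast
      then show ?thesis using i by (intro exI[of _ a] exI[of _ b]) auto
    qed
    have single: "i = j" if "(a, b) \<in> T" "a < i" "i \<le> b" "a < j" "j \<le> b" "?p i = - k" "?p j = - k" for i j a b
    proof -
      have "b \<le> ?n" using that T by auto
      then have "i - 1 \<in> {a..<b} \<and> v $ (i - 1) = - k" "j - 1 \<in> {a..<b} \<and> v $ (j - 1) = - k"
        using that p_Suc[of "i - 1"] p_Suc[of "j - 1"] by auto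
      moreover have "\<exists>!j. j \<in> {a..<b} \<and> v $ j = - k" using unique that by blast
      ultimately have "i - 1 = j - 1" by blast
      then show ?thesis using that by auto
    qed
    show "\<forall>j\<le>Suc ?n. \<forall>i<j. ?p i = ?p j \<and> ?p i \<noteq> 0 \<longrightarrow> (\<exists>l>i. l < j \<and> ?p l = - ?p i)"
    proof (intro allI impI, elim conjE)
      fix i j assume ij: "j \<le> Suc ?n" "i < j" "?p i = ?p j" "?p i \<noteq> 0"
      have "?p i \<in> {0, 1, -1}"
      proof (cases "i = 0")
        case False
        then have i: "i - 1 < ?n" using ij by linarith
        have "v $ (i - 1) \<in> {0, 1, -1}" using v vec_setI[OF refl i] by blast
        then show ?thesis using p_Suc[OF i] False by simp
      qed (simp add: padded_def)
      then consider "?p i = k" | "?p i = - k" "0 < i" | "?p i = - k" "j \<le> ?n" | "?p i = - k" "i = 0" "j = Suc ?n"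
        using k ij by force
      then show "\<exists>l>i. l < j \<and> ?p l = - ?p i"
      proof cases
        case 1
        define c where "c = (LEAST c. i < c \<and> ?p c = k)"
        have c: "i < c \<and> ?p c = k" unfolding c_def by (rule LeastI[of _ j]) (use ij 1 in auto)
        have cj: "c \<le> j" unfolding c_def by (rule Least_le) (use ij 1 in auto)
        have "\<forall>l\<in>{i<..c - 1}. ?p l \<noteq> k"
          using c not_less_Least[of _ "\<lambda>c. i < c \<and> ?p c = k", folded c_def] by auto
        then have "(i, c - 1) \<in> T" using c cj ij 1 unfolding T by auto
        then obtain l where "l \<in> {i..<c - 1}" "v $ l = - k" using unique by blast
        then show ?thesis using p_Suc[of l] 1 cj ij by (intro exI[of _ "Suc l"]) auto
      next
        case 2
        then obtain a b where ab: "(a, b) \<in> T" "a < i" "i \<le> b" using gap[of i] ij by auto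
        have "\<not> j \<le> b" using single[of a b i j] ab ij 2 by auto
        moreover have "j \<noteq> Suc b" using ab ij 2 k unfolding T by auto
        ultimately show ?thesis using ab 2 unfolding T by (intro exI[of _ "Suc b"]) auto
      next
        case 3
        then obtain a b where ab: "(a, b) \<in> T" "a < j" "j \<le> b" using gap[of j] ij by auto
        have "\<not> a < i" using single[of a b i j] ab ij 3 by auto
        moreover have "a \<noteq> i" using ab ij 3 k unfolding T by auto
        ultimately show ?thesis using ab 3 unfolding T by (intro exI[of _ a]) auto
      next
        case 4
        then have "k = 1" using p_end by auto
        then obtain l where "l < ?n" "v $ l = 1" using one by blast
        then show ?thesis using 4 p_Suc[of l] \<open>k = 1\<close> by (intro exI[of _ "Suc l"]) auto
      qed
    qed
  qed
qed

section \<open>Systems of distinct representatives\<close>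

text \<open>Hall's theorem by the argument of Halmos and Vaughan. If some non-empty proper subfamily is
  critical, i.e. has exactly as many candidates as members, it is served first, and the rest still
  satisfies the condition with these candidates removed. Otherwise each such subfamily has a candidate
  to spare, so one member may take any candidate without violating the condition for the rest.\<close>

lemma Hall_marriage:
  assumes "finite I" "\<And>i. i \<in> I \<Longrightarrow> finite (N i)"
    and "\<And>J. J \<subseteq> I \<Longrightarrow> card J \<le> card (\<Union>(N ` J))"
  shows "\<exists>f. inj_on f I \<and> (\<forall>i\<in>I. f i \<in> N i)"
  using assms
proof (induction "card I" arbitrary: I N rule: less_induct)
  case less
  note fin = \<open>finite I\<close> less.prems(2) and hall = less.prems(3)
  have fin_N: "finite (\<Union>(N ` J))" if "J \<subseteq> I" for J
    using that fin finite_subset by blast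
  show ?case
  proof (cases "\<exists>J. J \<subset> I \<and> J \<noteq> {} \<and> card J = card (\<Union>(N ` J))")
    case True
    then obtain J where J: "J \<subset> I" "J \<noteq> {}" "card J = card (\<Union>(N ` J))" by blast
    define U where "U = \<Union>(N ` J)"
    have finJ: "finite J" using J fin(1) finite_subset by blast
    have lt: "card J < card I" "card (I - J) < card I"
      using J fin(1) by (intro psubset_card_mono; auto)+
    obtain f where f: "inj_on f J" "\<forall>i\<in>J. f i \<in> N i"
    proof -
      have "\<exists>f. inj_on f J \<and> (\<forall>i\<in>J. f i \<in> N i)"
        by (rule less.hyps[OF lt(1) finJ]) (use J fin(2) hall in auto)
      then show thesis using that by blast
    qed
    have card_diff: "card K \<le> card (\<Union>i\<in>K. N i - U)" if K: "K \<subseteq> I - J" for K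
    proof -
      have "card J + card K = card (J \<union> K)"
        using K finJ fin(1) by (subst card_Un_disjoint) (auto intro: finite_subset)
      also have "\<dots> \<le> card (\<Union>(N ` (J \<union> K)))"
        using J K by (intro hall) auto
      also have "\<Union>(N ` (J \<union> K)) = U \<union> (\<Union>i\<in>K. N i - U)"
        by (auto simp: U_def)
      also have "card \<dots> \<le> card U + card (\<Union>i\<in>K. N i - U)"
        by (rule card_Un_le)
      finally show ?thesis using J(3) by (simp add: U_def)
    qed
    obtain g where g: "inj_on g (I - J)" "\<forall>i\<in>I - J. g i \<in> N i - U"
    proof -
      have "\<exists>g. inj_on g (I - J) \<and> (\<forall>i\<in>I - J. g i \<in> N i - U)"
        by (rule less.hyps[OF lt(2)]) (use fin card_diff in auto)
      then show thesis using that by blast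
    qed
    define h where "h = (\<lambda>i. if i \<in> J then f i else g i)"
    have "inj_on h I"
    proof (rule inj_onI)
      fix x y assume xy: "x \<in> I" "y \<in> I" "h x = h y"
      have "f i \<in> U" if "i \<in> J" for i using f that by (auto simp: U_def)
      then show "x = y"
        using xy f g by (auto simp: h_def split: if_splits dest: inj_onD) (metis DiffI)+
    qed
    moreover have "\<forall>i\<in>I. h i \<in> N i" using f g by (auto simp: h_def)
    ultimately show ?thesis by blast
  next
    case False
    show ?thesis
    proof (cases "I = {}")
      case False
      then obtain i where i: "i \<in> I" by blast
      have "N i \<noteq> {}" using hall[of "{i}"] i by auto
      then obtain y where y: "y \<in> N i" by blast
      have lt: "card (I - {i}) < card I" using i fin(1) by (intro psubset_card_mono) auto
      have card_diff: "card K \<le> card (\<Union>l\<in>K. N l - {y})" if K: "K \<subseteq> I - {i}" for K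
      proof (cases "K = {}")
        case False
        have "K \<subset> I" using K i by blast
        with False \<open>\<not> (\<exists>J. J \<subset> I \<and> J \<noteq> {} \<and> card J = card (\<Union>(N ` J)))\<close>
        have "card K \<noteq> card (\<Union>(N ` K))" by blast
        with hall[of K] \<open>K \<subset> I\<close> have "card K < card (\<Union>(N ` K))" by auto
        moreover have "(\<Union>l\<in>K. N l - {y}) = \<Union>(N ` K) - {y}" by blast
        moreover have "finite (\<Union>(N ` K))" using fin_N \<open>K \<subset> I\<close> by blast
        ultimately show ?thesis by (auto simp: card_Diff_singleton_if)
      qed simp
      have "\<exists>g. inj_on g (I - {i}) \<and> (\<forall>l\<in>I - {i}. g l \<in> N l - {y})"
        by (rule less.hyps[OF lt]) (use fin card_diff in auto)
      then obtain g where g: "inj_on g (I - {i})" "\<forall>l\<in>I - {i}. g l \<in> N l - {y}"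
        by blast
      have "inj_on (g(i := y)) I"
        using g by (auto simp: inj_on_def)
      moreover have "\<forall>l\<in>I. (g(i := y)) l \<in> N l" using g y by auto
      ultimately show ?thesis by blast
    qed simp
  qed
qed

text \<open>The families \<open>F\<close> and \<open>G\<close> of pairwise disjoint sets play the roles of the row and the column regions.
  A set \<open>M\<close> that meets each of them exactly once and has no other elements has as many elements as
  there are members of \<open>R\<close>. If \<open>P\<close> and \<open>Q\<close> do not overlap, the elements of \<open>M\<close> in the sets of \<open>P\<close> and
  those in the sets of \<open>Q\<close> are all different, which bounds \<open>card P + card Q\<close>. Conversely, a violation
  \<open>J\<close> of Hall's condition for the relation "the two sets have an element in common" leaves so many
  sets without an element in common with those of \<open>J\<close> that together they are too many; so there is a
  matching, and \<open>M\<close> takes one common element from each matched pair.\<close>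

lemma exact_cover_iff_no_large_disjoint_families:
  fixes F :: "'p \<Rightarrow> 'c set" and G :: "'q \<Rightarrow> 'c set"
  assumes "finite R" "finite S" and card: "card R = card S"
    and F: "\<And>x p p'. p \<in> R \<Longrightarrow> p' \<in> R \<Longrightarrow> x \<in> F p \<Longrightarrow> x \<in> F p' \<Longrightarrow> p = p'"
    and G: "\<And>x q q'. q \<in> S \<Longrightarrow> q' \<in> S \<Longrightarrow> x \<in> G q \<Longrightarrow> x \<in> G q' \<Longrightarrow> q = q'"
  shows "(\<exists>M. (\<forall>p\<in>R. \<exists>!x. x \<in> M \<inter> F p) \<and> (\<forall>q\<in>S. \<exists>!x. x \<in> M \<inter> G q) \<and>
      M \<subseteq> \<Union>(F ` R) \<and> M \<subseteq> \<Union>(G ` S)) \<longleftrightarrow>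
    \<not> (\<exists>P Q. P \<subseteq> R \<and> Q \<subseteq> S \<and> card P + card Q = card R + 1 \<and> (\<forall>p\<in>P. \<forall>q\<in>Q. F p \<inter> G q = {}))"
    (is "?cover \<longleftrightarrow> \<not> ?big")
proof
  assume ?cover
  then obtain M where M: "\<forall>p\<in>R. \<exists>!x. x \<in> M \<inter> F p" "\<forall>q\<in>S. \<exists>!x. x \<in> M \<inter> G q"
      "M \<subseteq> \<Union>(F ` R)" "M \<subseteq> \<Union>(G ` S)"
    by blast
  show "\<not> ?big"
  proof
    assume ?big
    then obtain P Q where PQ: "P \<subseteq> R" "Q \<subseteq> S" "card P + card Q = card R + 1"
        "\<forall>p\<in>P. \<forall>q\<in>Q. F p \<inter> G q = {}" by blast
    obtain f where f: "\<And>p. p \<in> R \<Longrightarrow> f p \<in> M \<inter> F p" using M(1) by metis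
    obtain g where g: "\<And>q. q \<in> S \<Longrightarrow> g q \<in> M \<inter> G q" using M(2) by metis
    have inj: "inj_on f P" "inj_on g Q"
      using f g F G PQ(1,2) by (auto intro!: inj_onI, (metis IntD2 in_mono)+)
    have M_sub: "M \<subseteq> f ` R"
    proof
      fix x assume x: "x \<in> M"
      then obtain p where "p \<in> R" "x \<in> F p" using M(3) by blast
      then have "x = f p" using M(1) f[of p] x by blast
      then show "x \<in> f ` R" using \<open>p \<in> R\<close> by blast
    qed
    have "f ` P \<inter> g ` Q = {}"
      using f g PQ by (auto, metis IntD2 IntI empty_iff in_mono)
    have fin: "finite P" "finite Q" "finite M"
      using PQ assms(1,2) M_sub finite_subset by blast+
    have "card P + card Q = card (f ` P \<union> g ` Q)"
      using \<open>f ` P \<inter> g ` Q = {}\<close> fin inj by (simp add: card_Un_disjoint card_image)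
    also have "\<dots> \<le> card M"
      using fin PQ f g by (intro card_mono) auto
    also have "\<dots> \<le> card R"
      using M_sub assms(1) by (rule surj_card_le[rotated])
    finally show False using PQ by simp
  qed
next
  assume no: "\<not> ?big"
  define N where "N = (\<lambda>p. {q \<in> S. F p \<inter> G q \<noteq> {}})"
  have "card J \<le> card (\<Union>(N ` J))" if J: "J \<subseteq> R" for J
  proof (rule ccontr)
    assume neg: "\<not> card J \<le> card (\<Union>(N ` J))"
    define Q where "Q = S - \<Union>(N ` J)"
    have sub: "\<Union>(N ` J) \<subseteq> S" by (auto simp: N_def)
    \<comment> \<open>\<open>card J + card Q\<close> exceeds \<open>card R\<close>, possibly by more than one; a subset of \<open>J\<close> gives the
      exact number.\<close>
    then have "card Q = card S - card (\<Union>(N ` J))" "card (\<Union>(N ` J)) \<le> card S"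
      using assms(2) by (auto simp: Q_def card_Diff_subset finite_subset card_mono)
    with neg card have "card R + 1 - card Q \<le> card J" "card Q \<le> card R + 1" by auto
    moreover obtain P where "P \<subseteq> J" "card P = card R + 1 - card Q"
      using obtain_subset_with_card_n[OF calculation(1)] by metis
    ultimately have "P \<subseteq> R" "Q \<subseteq> S" "card P + card Q = card R + 1"
      "\<forall>p\<in>P. \<forall>q\<in>Q. F p \<inter> G q = {}"
      using J by (auto simp: Q_def N_def)
    with no show False by blast
  qed
  then have "\<exists>f. inj_on f R \<and> (\<forall>p\<in>R. f p \<in> N p)"
    using assms(1,2) by (intro Hall_marriage) (auto simp: N_def)
  then obtain f where f: "inj_on f R" "\<And>p. p \<in> R \<Longrightarrow> f p \<in> N p" by blast
  have f_surj: "f ` R = S"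
    using f assms(1,2) card by (intro card_subset_eq) (auto simp: N_def card_image)
  have "\<exists>x. x \<in> F p \<inter> G (f p)" if "p \<in> R" for p
    using f(2)[OF that] by (auto simp: N_def)
  then obtain c where c: "\<And>p. p \<in> R \<Longrightarrow> c p \<in> F p \<and> c p \<in> G (f p)" by (metis IntE)
  \<comment> \<open>An element chosen for another pair lies in another set of each family, as \<open>f\<close> is injective.\<close>
  have F_eq: "c ` R \<inter> F p = {c p}" if "p \<in> R" for p
    using c F that by blast
  have G_eq: "c ` R \<inter> G (f p) = {c p}" if p: "p \<in> R" for p
  proof -
    have "p' = p" if "p' \<in> R" "c p' \<in> G (f p)" for p'
    proof -
      have "f p' = f p" using G[of "f p'" "f p"] c that p f_surj by blast
      then show ?thesis using f(1) p that by (auto dest: inj_onD)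
    qed
    then show ?thesis using c p by blast
  qed
  have "\<forall>q\<in>S. \<exists>!x. x \<in> c ` R \<inter> G q"
    using G_eq f_surj by force
  moreover have "\<forall>p\<in>R. \<exists>!x. x \<in> c ` R \<inter> F p"
    using F_eq by simp
  moreover have "c ` R \<subseteq> \<Union>(F ` R)" "c ` R \<subseteq> \<Union>(G ` S)"
    using c f_surj by blast+
  ultimately show ?cover by blast
qed

section \<open>Row and column regions of a matrix\<close>

lemma row_sign_part:
  "i < dim_row A \<Longrightarrow> row (sign_part k A) i = sign_part_vec k (row A i)"
  by (auto simp: sign_part_def sign_part_vec_def)

lemma col_sign_part:
  "j < dim_col A \<Longrightarrow> col (sign_part k A) j = sign_part_vec k (col A j)"
  by (auto simp: sign_part_def sign_part_vec_def)

text \<open>The characterisation of alternating lines, collected over all rows and phrased with cells instead of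
  positions in a line.\<close>

lemma rows_alternating_iff:
  assumes k: "k \<in> {1, -1}" and A: "A \<in> carrier_mat n n" "elements_mat A \<subseteq> {0, 1, -1}"
  defines "R \<equiv> row_regions k 1 (sign_part k A)"
  shows "(\<forall>i<n. alternating_line (row A i)) \<longleftrightarrow>
    (k = 1 \<longrightarrow> (\<forall>i<n. \<exists>j<n. A $$ (i, j) = 1)) \<and>
    (\<forall>p\<in>R. \<exists>!c. c \<in> row_cells p \<and> A $$ c = - k) \<and>
    (\<forall>i<n. \<forall>j<n. A $$ (i, j) = - k \<longrightarrow> (\<exists>p\<in>R. (i, j) \<in> row_cells p))"
proof -
  define T where "T i = typed_line_regions k 1 (sign_part_vec k (row A i))" for i
  have R: "(i, a, b) \<in> R \<longleftrightarrow> i < n \<and> (a, b) \<in> T i" for i a b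
    using A row_sign_part[of i A k] by (auto simp: R_def row_regions_def T_def sign_part_def)
  have elem: "A $$ (i, j) \<in> {0, 1, -1}" if "i < n" "j < n" for i j
    using A that elements_matI[of A n n i j] by auto
  have line: "alternating_line (row A i) \<longleftrightarrow>
      (k = 1 \<longrightarrow> (\<exists>j<n. A $$ (i, j) = 1)) \<and>
      (\<forall>(a, b)\<in>T i. \<exists>!j. j \<in> {a..<b} \<and> A $$ (i, j) = - k) \<and>
      (\<forall>j<n. A $$ (i, j) = - k \<longrightarrow> (\<exists>(a, b)\<in>T i. j \<in> {a..<b}))" if i: "i < n" for i
  proof -
    have entries: "set\<^sub>v (row A i) \<subseteq> {0, 1, -1}"
      using A elem i by (auto simp: vec_set_def row_def)
    have inside: "b \<le> n" if "(a, b) \<in> T i" for a b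
      using that A typed_line_regions_iff_gap[OF k entries] by (auto simp: T_def)
    have index: "row A i $ j = A $$ (i, j)" if "j < n" for j
      using A i that by simp
    have uniq: "(\<exists>!j. j \<in> {a..<b} \<and> row A i $ j = - k) \<longleftrightarrow> (\<exists>!j. j \<in> {a..<b} \<and> A $$ (i, j) = - k)"
      if ab: "(a, b) \<in> T i" for a b
    proof -
      have "(j \<in> {a..<b} \<and> row A i $ j = - k) \<longleftrightarrow> (j \<in> {a..<b} \<and> A $$ (i, j) = - k)" for j
        using inside[OF ab] index[of j] by auto
      then show ?thesis by presburger
    qed
    have "(\<forall>(a, b)\<in>T i. \<exists>!j. j \<in> {a..<b} \<and> row A i $ j = - k) \<longleftrightarrow>
        (\<forall>(a, b)\<in>T i. \<exists>!j. j \<in> {a..<b} \<and> A $$ (i, j) = - k)"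
      by (intro ball_cong refl) (simp only: split_paired_all prod.case uniq)
    moreover have "dim_vec (row A i) = n" using A by simp
    ultimately show ?thesis
      unfolding alternating_line_iff_regions[OF k entries] T_def[symmetric]
      using index by (simp cong: conj_cong)
  qed
  have unique: "(\<exists>!c. c \<in> row_cells (i, a, b) \<and> A $$ c = - k) \<longleftrightarrow>
      (\<exists>!j. j \<in> {a..<b} \<and> A $$ (i, j) = - k)" for i a b
    by (auto simp: Ex1_def)
  have ball_R: "(\<forall>i<n. \<forall>(a, b)\<in>T i. \<Phi> (i, a, b)) \<longleftrightarrow> (\<forall>p\<in>R. \<Phi> p)" for \<Phi>
    using R by auto
  have bex_R: "(\<exists>(a, b)\<in>T i. j \<in> {a..<b}) \<longleftrightarrow> (\<exists>p\<in>R. (i, j) \<in> row_cells p)" if "i < n" for i j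
    using that by (auto simp: Bex_def R)
  have "(\<forall>i<n. alternating_line (row A i)) \<longleftrightarrow>
      (\<forall>i<n. (k = 1 \<longrightarrow> (\<exists>j<n. A $$ (i, j) = 1)) \<and>
        (\<forall>(a, b)\<in>T i. \<exists>!c. c \<in> row_cells (i, a, b) \<and> A $$ c = - k) \<and>
        (\<forall>j<n. A $$ (i, j) = - k \<longrightarrow> (\<exists>p\<in>R. (i, j) \<in> row_cells p)))"
    unfolding unique by (intro all_cong1 imp_cong refl) (simp only: line bex_R)
  also have "\<dots> \<longleftrightarrow> (k = 1 \<longrightarrow> (\<forall>i<n. \<exists>j<n. A $$ (i, j) = 1)) \<and>
      (\<forall>i<n. \<forall>(a, b)\<in>T i. \<exists>!c. c \<in> row_cells (i, a, b) \<and> A $$ c = - k) \<and>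
      (\<forall>i<n. \<forall>j<n. A $$ (i, j) = - k \<longrightarrow> (\<exists>p\<in>R. (i, j) \<in> row_cells p))"
    by blast
  also have "(\<forall>i<n. \<forall>(a, b)\<in>T i. \<exists>!c. c \<in> row_cells (i, a, b) \<and> A $$ c = - k) \<longleftrightarrow>
      (\<forall>p\<in>R. \<exists>!c. c \<in> row_cells p \<and> A $$ c = - k)"
    by (rule ball_R)
  finally show ?thesis .
qed

lemma col_cells_eq_swap: "col_cells q = prod.swap ` row_cells q"
  by (cases q) auto

text \<open>Statements about columns are obtained from those about rows through transposition, which exchanges
  the coordinates of each cell.\<close>

lemma col_regions_eq_transpose:
  "col_regions k t X = row_regions k t (transpose_mat X)"
  by (auto simp: col_regions_def row_regions_def)

lemma columns_alternating_iff:
  assumes k: "k \<in> {1, -1}" and A: "A \<in> carrier_mat n n" "elements_mat A \<subseteq> {0, 1, -1}"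
  defines "S \<equiv> col_regions k 1 (sign_part k A)"
  shows "(\<forall>j<n. alternating_line (col A j)) \<longleftrightarrow>
    (k = 1 \<longrightarrow> (\<forall>j<n. \<exists>i<n. A $$ (i, j) = 1)) \<and>
    (\<forall>q\<in>S. \<exists>!c. c \<in> col_cells q \<and> A $$ c = - k) \<and>
    (\<forall>i<n. \<forall>j<n. A $$ (i, j) = - k \<longrightarrow> (\<exists>q\<in>S. (i, j) \<in> col_cells q))"
proof -
  define B where "B = transpose_mat A"
  have B: "B \<in> carrier_mat n n" "elements_mat B \<subseteq> {0, 1, -1}"
    using A by (auto simp: B_def elements_mat_def)
  have entry: "B $$ (j, i) = A $$ (i, j)" if "i < n" "j < n" for i j
    using A that by (simp add: B_def)
  have S: "S = row_regions k 1 (sign_part k B)"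
  proof -
    have "transpose_mat (sign_part k A) = sign_part k B"
      using A by (auto simp: B_def sign_part_def)
    then show ?thesis by (simp add: S_def col_regions_eq_transpose)
  qed
  have inside: "row_cells q \<subseteq> {..<n} \<times> {..<n}" if "q \<in> S" for q
    using that B
    by (cases q) (auto simp: S row_regions_def typed_line_regions_def line_regions_def sign_part_def
        split: if_splits)
  have "(\<exists>!c. c \<in> col_cells q \<and> A $$ c = - k) \<longleftrightarrow> (\<exists>!c. c \<in> row_cells q \<and> B $$ c = - k)"
    if "q \<in> S" for q
  proof -
    have mem: "c \<in> row_cells q \<and> B $$ c = - k \<longleftrightarrow> prod.swap c \<in> col_cells q \<and> A $$ (prod.swap c) = - k" for c
    proof (cases c)
      case (Pair j i)
      have "B $$ (j, i) = A $$ (i, j)" if "(j, i) \<in> row_cells q"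
        using inside[OF \<open>q \<in> S\<close>] that by (intro entry) auto
      moreover have "(i, j) \<in> col_cells q \<longleftrightarrow> (j, i) \<in> row_cells q"
        by (cases q) auto
      ultimately show ?thesis using Pair by auto
    qed
    have swap: "(\<exists>!c. P c) \<longleftrightarrow> (\<exists>!c. P (prod.swap c))" for P :: "nat \<times> nat \<Rightarrow> bool"
      by (simp add: Ex1_def) blast
    show ?thesis
      unfolding mem by (rule swap)
  qed
  then have "(\<forall>q\<in>S. \<exists>!c. c \<in> row_cells q \<and> B $$ c = - k) \<longleftrightarrow>
      (\<forall>q\<in>S. \<exists>!c. c \<in> col_cells q \<and> A $$ c = - k)"
    by simp
  moreover have "(\<forall>i<n. \<exists>j<n. B $$ (i, j) = 1) \<longleftrightarrow> (\<forall>j<n. \<exists>i<n. A $$ (i, j) = 1)"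
    using entry by (simp cong: conj_cong)
  moreover have "(\<forall>i<n. \<forall>j<n. B $$ (i, j) = - k \<longrightarrow> (\<exists>q\<in>S. (i, j) \<in> row_cells q)) \<longleftrightarrow>
      (\<forall>i<n. \<forall>j<n. A $$ (i, j) = - k \<longrightarrow> (\<exists>q\<in>S. (i, j) \<in> col_cells q))"
  proof -
    have "(j, i) \<in> col_cells q \<longleftrightarrow> (i, j) \<in> row_cells q" for i j q
      by (cases q) auto
    then show ?thesis using entry by auto
  qed
  moreover have "(\<forall>j<n. alternating_line (col A j)) \<longleftrightarrow> (\<forall>j<n. alternating_line (row B j))"
    using A by (simp add: B_def)
  ultimately show ?thesis
    by (simp only: rows_alternating_iff[OF k B, folded S])
qed

text \<open>Regions are maximal runs of zeros, so if two of them share a position, neither can start or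
  end strictly inside the other.\<close>

lemma line_regions_unique:
  assumes "(a, b) \<in> line_regions v" "(a', b') \<in> line_regions v" "j \<in> {a..<b}" "j \<in> {a'..<b'}"
  shows "a = a'" "b = b'"
proof -
  have le: "a \<le> a' \<and> b' \<le> b"
    if "(a, b) \<in> line_regions v" "(a', b') \<in> line_regions v" "j \<in> {a..<b}" "j \<in> {a'..<b'}"
    for a b a' b'
  proof (rule conjI; rule ccontr)
    assume "\<not> a \<le> a'"
    then have "a - 1 \<in> {a'..<b'}" "a \<noteq> 0" using that by auto
    then show False using that unfolding line_regions_def by auto
  next
    assume "\<not> b' \<le> b"
    then have "b \<in> {a'..<b'}" "b \<noteq> dim_vec v" using that unfolding line_regions_def by auto
    then show False using that unfolding line_regions_def by auto
  qed
  show "a = a'" "b = b'"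
    using le[OF assms] le[OF assms(2,1,4,3)] by auto
qed

lemma row_regions_unique:
  assumes "p \<in> row_regions k t X" "p' \<in> row_regions k t X" "x \<in> row_cells p" "x \<in> row_cells p'"
  shows "p = p'"
proof -
  obtain i a b i' a' b' where p: "p = (i, a, b)" "p' = (i', a', b')" by (metis prod_cases3)
  have "(c, d) \<in> line_regions v" if "(c, d) \<in> typed_line_regions k t v" for c d v
    using that by (auto simp: typed_line_regions_def split: if_splits)
  then show ?thesis
    using assms line_regions_unique[of a b "row X i" a' b' "snd x"]
    by (auto simp: p row_regions_def)
qed

lemma finite_row_regions: "finite (row_regions k t X)"
proof (rule finite_subset)
  show "row_regions k t X \<subseteq> {..<dim_row X} \<times> {..dim_col X} \<times> {..dim_col X}"
    by (auto simp: row_regions_def typed_line_regions_def line_regions_def split: if_splits)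
qed simp

lemma col_regions_unique:
  assumes "q \<in> col_regions k t X" "q' \<in> col_regions k t X" "x \<in> col_cells q" "x \<in> col_cells q'"
  shows "q = q'"
  using assms row_regions_unique[of q k t "transpose_mat X" q' "prod.swap x"]
  by (auto simp: col_regions_eq_transpose col_cells_eq_swap)

lemma row_region_zero:
  assumes "p \<in> row_regions k t X" "(i, j) \<in> row_cells p"
  shows "i < dim_row X" "j < dim_col X" "X $$ (i, j) = 0"
proof -
  obtain a b where p: "p = (i, a, b)" "j \<in> {a..<b}"
    using assms(2) by (cases p) auto
  then have "i < dim_row X" and ab: "(a, b) \<in> line_regions (row X i)"
    using assms(1) by (auto simp: row_regions_def typed_line_regions_def split: if_splits)
  moreover have "b \<le> dim_col X" "row X i $ j = 0"
    using ab p(2) by (auto simp: line_regions_def)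
  ultimately show "i < dim_row X" "j < dim_col X" "X $$ (i, j) = 0"
    using p(2) by auto
qed

lemma row_cells_inside:
  "p \<in> row_regions k t X \<Longrightarrow> row_cells p \<subseteq> {..<dim_row X} \<times> {..<dim_col X}"
  by (rule subrelI) (auto dest: row_region_zero(1,2))

lemma col_cells_inside:
  "q \<in> col_regions k t X \<Longrightarrow> col_cells q \<subseteq> {..<dim_row X} \<times> {..<dim_col X}"
  using row_cells_inside[of q k t "transpose_mat X"]
  by (auto simp: col_regions_eq_transpose col_cells_eq_swap)

section \<open>Alternating sign matrices with a given sign part\<close>

text \<open>The set \<open>M\<close> is the set of positions of the entries \<open>- k\<close>. It determines \<open>A\<close>, since all other entries
  are those of \<open>X\<close>, and the rows and columns of \<open>A\<close> alternate exactly if \<open>M\<close> meets each region once and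
  lies within the regions of both directions. When \<open>k = 1\<close>, each line also needs an entry \<open>1\<close>; this
  is where non-zero lines of \<open>X\<close> enter.\<close>

lemma alternating_sign_matrix_iff_transversal:
  fixes k :: int
  assumes k: "k \<in> {1, -1}" and X: "X \<in> carrier_mat n n" "elements_mat X \<subseteq> {0, k}"
    and nonzero: "k = 1 \<Longrightarrow> (\<forall>i<n. row X i \<noteq> 0\<^sub>v n) \<and> (\<forall>j<n. col X j \<noteq> 0\<^sub>v n)"
  defines "R \<equiv> row_regions k 1 X" and "S \<equiv> col_regions k 1 X"
  shows "(\<exists>A. alternating_sign_matrix n A \<and> sign_part k A = X) \<longleftrightarrow>
    (\<exists>M. (\<forall>p\<in>R. \<exists>!c. c \<in> M \<inter> row_cells p) \<and> (\<forall>q\<in>S. \<exists>!c. c \<in> M \<inter> col_cells q) \<and>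
      M \<subseteq> \<Union>(row_cells ` R) \<and> M \<subseteq> \<Union>(col_cells ` S))"
    (is "?asm \<longleftrightarrow> (\<exists>M. ?transversal M)")
proof -
  have row_inside: "row_cells p \<subseteq> {..<n} \<times> {..<n}" if "p \<in> R" for p
    using row_cells_inside[of p k 1 X] that X(1) by (simp add: R_def)
  have col_inside: "col_cells q \<subseteq> {..<n} \<times> {..<n}" if "q \<in> S" for q
    using col_cells_inside[of q k 1 X] that X(1) by (simp add: S_def)
  show ?thesis
  proof
    assume ?asm
    then obtain A where A: "alternating_sign_matrix n A" "sign_part k A = X" by blast
    then have carrier: "A \<in> carrier_mat n n" "elements_mat A \<subseteq> {0, 1, -1}"
      by (auto simp: alternating_sign_matrix_def)
    define M where "M = {c \<in> {..<n} \<times> {..<n}. A $$ c = - k}"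
    have rows: "\<forall>p\<in>R. \<exists>!c. c \<in> row_cells p \<and> A $$ c = - k"
      "\<forall>i<n. \<forall>j<n. A $$ (i, j) = - k \<longrightarrow> (\<exists>p\<in>R. (i, j) \<in> row_cells p)"
      using A rows_alternating_iff[OF k carrier] by (auto simp: alternating_sign_matrix_def R_def)
    have cols: "\<forall>q\<in>S. \<exists>!c. c \<in> col_cells q \<and> A $$ c = - k"
      "\<forall>i<n. \<forall>j<n. A $$ (i, j) = - k \<longrightarrow> (\<exists>q\<in>S. (i, j) \<in> col_cells q)"
      using A columns_alternating_iff[OF k carrier] by (auto simp: alternating_sign_matrix_def S_def)
    have row_eq: "c \<in> M \<inter> row_cells p \<longleftrightarrow> c \<in> row_cells p \<and> A $$ c = - k" if "p \<in> R" for p c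
      using row_inside[OF that] by (auto simp: M_def)
    have col_eq: "c \<in> M \<inter> col_cells q \<longleftrightarrow> c \<in> col_cells q \<and> A $$ c = - k" if "q \<in> S" for q c
      using col_inside[OF that] by (auto simp: M_def)
    have "\<forall>p\<in>R. \<exists>!c. c \<in> M \<inter> row_cells p"
      by (intro ballI) (simp only: row_eq rows(1)[rule_format])
    moreover have "\<forall>q\<in>S. \<exists>!c. c \<in> M \<inter> col_cells q"
      by (intro ballI) (simp only: col_eq cols(1)[rule_format])
    moreover have "M \<subseteq> \<Union>(row_cells ` R)" "M \<subseteq> \<Union>(col_cells ` S)"
      using rows(2) cols(2) by (auto simp: M_def)
    ultimately have "?transversal M" by blast
    then show "\<exists>M. ?transversal M" by blast
  next
    assume "\<exists>M. ?transversal M"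
    then obtain M where M: "?transversal M" by blast
    then have M_row: "\<exists>!c. c \<in> M \<inter> row_cells p" if "p \<in> R" for p
      using that by blast
    from M have M_col: "\<exists>!c. c \<in> M \<inter> col_cells q" if "q \<in> S" for q
      using that by blast
    define A where "A = mat n n (\<lambda>c. if c \<in> M then - k else X $$ c)"
    have entry: "X $$ (i, j) \<in> {0, k}" if "i < n" "j < n" for i j
      using X that elements_matI[of X n n i j] by auto
    have in_M: "i < n \<and> j < n \<and> X $$ (i, j) = 0" if ij: "(i, j) \<in> M" for i j
    proof -
      obtain p where "p \<in> R" "(i, j) \<in> row_cells p" using M ij by blast
      then show ?thesis using row_region_zero[of p k 1 X i j] X(1) by (auto simp: R_def)
    qed
    have iff: "A $$ c = - k \<longleftrightarrow> c \<in> M" if "c \<in> {..<n} \<times> {..<n}" for c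
      using that entry[of "fst c" "snd c"] k by (cases c) (auto simp: A_def)
    have one: "A $$ (i, j) = 1" if "k = 1" "i < n" "j < n" "X $$ (i, j) \<noteq> 0" for i j
      using that entry[of i j] in_M[of i j] by (auto simp: A_def)
    have carrier: "A \<in> carrier_mat n n" by (simp add: A_def)
    have elems: "elements_mat A \<subseteq> {0, 1, -1}"
    proof
      fix a assume "a \<in> elements_mat A"
      then obtain i j where ij: "i < n" "j < n" "a = A $$ (i, j)"
        using carrier by (auto simp: elements_mat_def)
      then show "a \<in> {0, 1, -1}" using entry[OF ij(1,2)] k by (auto simp: A_def)
    qed
    have sign: "sign_part k A = X"
    proof (rule eq_matI)
      fix i j assume "i < dim_row X" "j < dim_col X"
      then have ij: "i < n" "j < n" using X(1) by auto
      show "sign_part k A $$ (i, j) = X $$ (i, j)"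
        using entry[OF ij] in_M[of i j] ij k by (auto simp: sign_part_def A_def)
    qed (use X(1) in \<open>auto simp: sign_part_def A_def\<close>)
    have rows_ne: "\<forall>i<n. \<exists>j<n. A $$ (i, j) = 1" if "k = 1"
    proof (intro allI impI)
      fix i assume i: "i < n"
      have "\<exists>j<n. X $$ (i, j) \<noteq> 0"
      proof (rule ccontr)
        assume "\<not> ?thesis"
        then have "row X i = 0\<^sub>v n" using X(1) i by (intro eq_vecI) auto
        then show False using nonzero that i by blast
      qed
      then show "\<exists>j<n. A $$ (i, j) = 1" using one that i by blast
    qed
    have cols_ne: "\<forall>j<n. \<exists>i<n. A $$ (i, j) = 1" if "k = 1"
    proof (intro allI impI)
      fix j assume j: "j < n"
      have "\<exists>i<n. X $$ (i, j) \<noteq> 0"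
      proof (rule ccontr)
        assume "\<not> ?thesis"
        then have "col X j = 0\<^sub>v n" using X(1) j by (intro eq_vecI) auto
        then show False using nonzero that j by blast
      qed
      then show "\<exists>i<n. A $$ (i, j) = 1" using one that j by blast
    qed
    have row_eq: "c \<in> row_cells p \<and> A $$ c = - k \<longleftrightarrow> c \<in> M \<inter> row_cells p" if "p \<in> R" for p c
      using row_inside[OF that] iff[of c] by blast
    have col_eq: "c \<in> col_cells q \<and> A $$ c = - k \<longleftrightarrow> c \<in> M \<inter> col_cells q" if "q \<in> S" for q c
      using col_inside[OF that] iff[of c] by blast
    have "\<forall>i<n. alternating_line (row A i)"
      unfolding rows_alternating_iff[OF k carrier elems] sign R_def[symmetric]
    proof (intro conjI impI allI)
      show "\<forall>p\<in>R. \<exists>!c. c \<in> row_cells p \<and> A $$ c = - k"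
        by (intro ballI) (simp only: row_eq M_row)
    next
      show "\<exists>p\<in>R. (i, j) \<in> row_cells p" if "i < n" "j < n" "A $$ (i, j) = - k" for i j
        using M iff[of "(i, j)"] that by blast
    qed (use rows_ne in blast)
    moreover have "\<forall>j<n. alternating_line (col A j)"
      unfolding columns_alternating_iff[OF k carrier elems] sign S_def[symmetric]
    proof (intro conjI impI allI)
      show "\<forall>q\<in>S. \<exists>!c. c \<in> col_cells q \<and> A $$ c = - k"
        by (intro ballI) (simp only: col_eq M_col)
    next
      show "\<exists>q\<in>S. (i, j) \<in> col_cells q" if "i < n" "j < n" "A $$ (i, j) = - k" for i j
        using M iff[of "(i, j)"] that by blast
    qed (use cols_ne in blast)
    ultimately show ?asm
      using carrier elems sign unfolding alternating_sign_matrix_def by blast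
  qed
qed

theorem theorem4p4:
  fixes k :: int and n m :: nat and X :: "int mat"
    and R S :: "(nat \<times> nat \<times> nat) set"
  assumes "k \<in> {1, -1}"
    and "X \<in> carrier_mat n n" and "elements_mat X \<subseteq> {0, k}"
    and "R = row_regions k 1 X" and "S = col_regions k 1 X"
    and "\<forall>p\<in>R. row_cells p \<noteq> {}" and "\<forall>q\<in>S. col_cells q \<noteq> {}"
    and "card R = m" and "card S = m"
    and "k = 1 \<Longrightarrow> (\<forall>i<n. row X i \<noteq> 0\<^sub>v n) \<and> (\<forall>j<n. col X j \<noteq> 0\<^sub>v n)"
  shows "(\<exists>A. alternating_sign_matrix n A \<and> sign_part k A = X) \<longleftrightarrow>
    \<not> (\<exists>P Q r s. P \<subseteq> R \<and> Q \<subseteq> S \<and> card P = r \<and> card Q = s \<and> r + s = m + 1 \<and>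
        non_overlapping P Q)"
proof -
  have fin: "finite R" "finite S"
    by (simp_all add: assms(4,5) col_regions_eq_transpose finite_row_regions)
  have card: "card R = card S"
    using assms(8,9) by simp
  have "(\<exists>A. alternating_sign_matrix n A \<and> sign_part k A = X) \<longleftrightarrow>
    (\<exists>M. (\<forall>p\<in>R. \<exists>!c. c \<in> M \<inter> row_cells p) \<and> (\<forall>q\<in>S. \<exists>!c. c \<in> M \<inter> col_cells q) \<and>
      M \<subseteq> \<Union>(row_cells ` R) \<and> M \<subseteq> \<Union>(col_cells ` S))"
    unfolding assms(4,5) by (rule alternating_sign_matrix_iff_transversal) (fact assms(1-3,10))+
  also have "\<dots> \<longleftrightarrow> \<not> (\<exists>P Q. P \<subseteq> R \<and> Q \<subseteq> S \<and> card P + card Q = card R + 1 \<and>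
      (\<forall>p\<in>P. \<forall>q\<in>Q. row_cells p \<inter> col_cells q = {}))"
    using fin card row_regions_unique col_regions_unique unfolding assms(4,5)
    by (rule exact_cover_iff_no_large_disjoint_families)
  finally show ?thesis
    using assms(8) by (simp add: non_overlapping_def)
qed

end
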